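(* Let $\mu>0$, $s>0$, and let $\varphi:\mathbb{R}\to\mathbb{R}$ be strictly convex on $\mathbb{R}$, differentiable on $\mathbb{R}\setminus\{\mu\}$, with $\lim_{|x|\to\infty}|\varphi(x)/x|=\infty$, $\varphi(\mu)=0$, and global minimum attained at $\mu$. Let $\psi:\mathbb{R}\to\mathbb{R}$ be a concave, increasing function and let $t<\mu$. Then $$\sup_{\mathbb{P}\in\mathcal{P}(\mu,s,\varphi)}\mathbb{E}(\psi(X)\mid X\ge t)=\psi(v_2),$$ where $v_2>\mu$ is the solution to $$\frac{v_2-\mu}{v_2-t}\varphi(t)+\frac{\mu-t}{v_2-t}\varphi(v_2)=s.$$ The supremum is approached by the two-point distributions in $\mathcal{P}(\mu,s,\varphi)$ whose left support point $v_1<\mu$ tends to $t$ from below ($v_1\uparrow t$).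
   Context: $\mathcal{P}(\mu,s,\varphi)$ is the set of all probability distributions $\mathbb{P}$ on $\mathbb{R}$ such that, for $X\sim\mathbb{P}$, $\mathbb{E}_{\mathbb{P}}(X)=\mu$ and $\mathbb{E}_{\mathbb{P}}(\varphi(X))=s$. A two-point distribution is a distribution supported on two points $v_1<\mu<v_2$ with probability masses $w_1,w_2$. *)

theory Defs
  imports "HOL-Probability.Probability"
begin

definition strictly_convex_on :: "'a::real_vector set \<Rightarrow> ('a \<Rightarrow> real) \<Rightarrow> bool" where
  "strictly_convex_on S f \<longleftrightarrow> convex S \<and>
    (\<forall>x\<in>S. \<forall>y\<in>S. \<forall>u>0. \<forall>v>0. x \<noteq> y \<longrightarrow> u + v = 1 \<longrightarrow>
      f (u *\<^sub>R x + v *\<^sub>R y) < u * f x + v * f y)"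

(* The random variable X is the identity on the real line.  Integrability is required
   explicitly because the Bochner integral of a non-integrable function is 0. *)
definition moment_class :: "real \<Rightarrow> real \<Rightarrow> (real \<Rightarrow> real) \<Rightarrow> real measure set" where
  "moment_class \<mu> s \<phi> = {P. real_distribution P \<and>
     integrable P (\<lambda>x. x) \<and> (LINT x|P. x) = \<mu> \<and>
     integrable P \<phi> \<and> (LINT x|P. \<phi> x) = s}"

(* The masses w1, w2 are the measures of {v1} and {v2}; as they add up to 1,
   nothing lies outside {v1, v2}. *)
definition two_point_distribution :: "real \<Rightarrow> real \<Rightarrow> real \<Rightarrow> real measure \<Rightarrow> bool" where
  "two_point_distribution \<mu> v1 v2 P \<longleftrightarrow> real_distribution P \<and> v1 < \<mu> \<and> \<mu> < v2 \<and>
     measure P {v1} > 0 \<and> measure P {v2} > 0 \<and> measure P {v1} + measure P {v2} = 1"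

(* E(psi(X) | X >= t), conditioning on an event.  The lemmas below show that for the
   distributions of interest neither a zero denominator nor a non-integrable
   integrand can occur. *)
definition cond_expectation_ge :: "real measure \<Rightarrow> (real \<Rightarrow> real) \<Rightarrow> real \<Rightarrow> real" where
  "cond_expectation_ge P \<psi> t = (LINT x:{t..}|P. \<psi> x) / measure P {t..}"

lemma moment_class_measure_ge_pos:
  assumes "P \<in> moment_class \<mu> s \<phi>" "t < \<mu>"
  shows "measure P {t..} > 0"
proof (rule ccontr)
  assume "\<not> measure P {t..} > 0"
  then have z: "measure P {t..} = 0"
    using measure_nonneg[of P "{t..}"] by linarith
  interpret real_distribution P
    using assms by (simp add: moment_class_def)
  have "{t..} \<in> null_sets P"
    using z by (auto simp: null_sets_def emeasure_eq_measure)
  then have "AE x in P. x \<le> t"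
    by (rule AE_I') auto
  then have "(LINT x|P. x) \<le> (LINT x|P. t)"
    using assms by (intro integral_mono_AE) (auto simp: moment_class_def)
  then show False
    using assms prob_space by (simp add: moment_class_def)
qed

lemma moment_class_set_integrable_ge:
  assumes P: "P \<in> moment_class \<mu> s \<phi>" and conc: "concave_on UNIV \<psi>" and mono: "mono \<psi>"
  shows "set_integrable P {t..} \<psi>"
proof -
  interpret real_distribution P
    using P by (simp add: moment_class_def)
  define d where "d = \<psi> t - \<psi> (t - 1)"
  have up: "\<psi> x \<le> \<psi> t + d * (x - t)" if "t \<le> x" for x
  proof -
    define v where "v = 1 / (x - t + 1)"
    define u where "u = (x - t) * v"
    have pos: "x - t + 1 > 0" using that by simp
    have uv: "u + v = 1" "u \<ge> 0" "v \<ge> 0"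
      using that pos by (auto simp: u_def v_def field_simps)
    have "u * (t - 1) + v * x = t"
      using pos by (simp add: u_def v_def divide_simps) (simp add: algebra_simps)
    then have "u * \<psi> (t - 1) + v * \<psi> x \<le> \<psi> t"
      using conc uv unfolding concave_on_iff
      by (metis UNIV_I real_scaleR_def)
    then have "(x - t + 1) * (u * \<psi> (t - 1) + v * \<psi> x) \<le> (x - t + 1) * \<psi> t"
      using pos by (intro mult_left_mono) auto
    moreover have "(x - t + 1) * (u * \<psi> (t - 1) + v * \<psi> x) = (x - t) * \<psi> (t - 1) + \<psi> x"
      using pos by (simp add: u_def v_def divide_simps) 
    ultimately show ?thesis by (simp add: d_def algebra_simps)
  qed
  have lo: "\<psi> t \<le> \<psi> x" if "t \<le> x" for x
    using mono that by (rule monoD)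
  have meas: "\<psi> \<in> borel_measurable borel"
    using mono by (rule borel_measurable_mono)
  have "integrable P (\<lambda>x. \<bar>\<psi> t\<bar> + \<bar>\<psi> t + d * (x - t)\<bar>)"
    using P by (auto simp: moment_class_def)
  then show ?thesis
    unfolding set_integrable_def
  proof (rule Bochner_Integration.integrable_bound)
    show "(\<lambda>x. indicator {t..} x *\<^sub>R \<psi> x) \<in> borel_measurable P"
      using meas by simp
    have "\<bar>\<psi> x\<bar> \<le> \<bar>\<psi> t\<bar> + \<bar>\<psi> t + d * (x - t)\<bar>" if "t \<le> x" for x
      using up[OF that] lo[OF that] by linarith
    then show "AE x in P. norm (indicator {t..} x *\<^sub>R \<psi> x)
        \<le> norm (\<bar>\<psi> t\<bar> + \<bar>\<psi> t + d * (x - t)\<bar>)"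
      by (auto simp: indicator_def)
  qed
qed

end

theory Submission
  imports Defs
begin

text \<open>
  For \<open>a < \<mu> < v\<close> there is exactly one distribution on \<open>{a, v}\<close> with mean \<open>\<mu>\<close>, and its
  \<open>\<phi>\<close>-moment is the height at \<open>\<mu>\<close> of the chord of \<open>\<phi>\<close> over \<open>[a, v]\<close> (\<open>chord_value\<close> below).
  For fixed \<open>a\<close> this height increases strictly and continuously with \<open>v\<close>, from \<open>\<phi> \<mu> = 0\<close> to
  infinity (superlinear growth), so each left support point \<open>a < \<mu>\<close> has exactly one partner,
  which depends continuously on \<open>a\<close>. Write \<open>v2\<close> for the partner of \<open>t\<close>.

  If \<open>a < t\<close>, the event \<open>X \<ge> t\<close> leaves only the right support point, so the conditional
  expectation of \<open>\<psi>\<close> is the value of \<open>\<psi>\<close> at the partner of \<open>a\<close>. It tends to \<open>\<psi> v2\<close> as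
  \<open>a\<close> increases to \<open>t\<close>, because \<open>\<psi>\<close> is continuous, being concave on the whole line.

  That no distribution does better is a duality argument. Let \<open>l\<close> be the line through the points
  of the graph of \<open>\<phi>\<close> over \<open>t\<close> and \<open>v2\<close>. As \<open>l \<mu> = s\<close>, the random variable \<open>\<phi> X - l X\<close> has
  mean \<open>0\<close> under every member of the moment class. It is nonnegative for \<open>X < t\<close>, and a
  suitable positive multiple of it dominates \<open>X - v2\<close> everywhere, since a supporting line of
  \<open>\<phi>\<close> at \<open>v2\<close> is steeper than \<open>l\<close>. Hence \<open>X - v2\<close> has mean at most \<open>0\<close> on the event
  \<open>X \<ge> t\<close> (\<open>truncated_mean_bound\<close>), and bounding \<open>\<psi>\<close> by a supporting line at \<open>v2\<close>, whose slope
  is nonnegative, gives the upper bound \<open>\<psi> v2\<close> (\<open>cond_expectation_ge_upper_bound\<close>).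
\<close>

section \<open>Convex functions on the line\<close>

lemma strictly_convex_on_imp_convex_on:
  fixes S :: "'a::real_vector set"
  assumes "strictly_convex_on S f"
  shows "convex_on S f"
proof (rule convex_onI)
  fix u :: real and x y :: 'a
  assume "0 < u" "u < 1" and xy: "x \<in> S" "y \<in> S"
  show "f ((1 - u) *\<^sub>R x + u *\<^sub>R y) \<le> (1 - u) * f x + u * f y"
  proof (cases "x = y")
    case True
    then show ?thesis by (simp add: algebra_simps flip: scaleR_add_left)
  next
    case False
    then have "f ((1 - u) *\<^sub>R x + u *\<^sub>R y) < (1 - u) * f x + u * f y"
      using assms xy \<open>0 < u\<close> \<open>u < 1\<close> unfolding strictly_convex_on_def by simp
    then show ?thesis by simp
  qed
qed (use assms in \<open>simp add: strictly_convex_on_def\<close>)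

lemma convex_on_real_supporting_line:
  fixes f :: "real \<Rightarrow> real"
  assumes "convex_on UNIV f"
  obtains m where "\<And>x. f c + m * (x - c) \<le> f x"
  using convex_le_Inf_differential[OF assms, of c] by auto

lemma concave_on_imp_continuous_on:
  fixes f :: "real \<Rightarrow> real"
  assumes "concave_on UNIV f"
  shows "continuous_on UNIV f"
proof -
  have "continuous_on UNIV (\<lambda>x. - f x)"
    using assms by (intro convex_on_continuous) (auto simp: concave_on_def)
  from continuous_on_minus[OF this] show ?thesis by simp
qed

section \<open>The height of a chord above a point\<close>

definition chord_value :: "(real \<Rightarrow> real) \<Rightarrow> real \<Rightarrow> real \<Rightarrow> real \<Rightarrow> real" where
  "chord_value f \<mu> a v = (v - \<mu>) / (v - a) * f a + (\<mu> - a) / (v - a) * f v"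

lemma chord_value_eq_slope:
  assumes "a < v"
  shows "chord_value f \<mu> a v = f a + (\<mu> - a) * ((f v - f a) / (v - a))"
  using assms by (simp add: chord_value_def divide_simps) (simp add: algebra_simps)

text \<open>The slopes of the chords that share the end point \<open>a\<close> increase with the other end point.\<close>

lemma chord_value_strict_mono:
  assumes cvx: "strictly_convex_on UNIV f" and "a < \<mu>" "a < v" "v < w"
  shows "chord_value f \<mu> a v < chord_value f \<mu> a w"
proof -
  define p where "p = (w - v) / (w - a)"
  define q where "q = (v - a) / (w - a)"
  have pq: "p > 0" "q > 0" "p + q = 1"
    using assms by (auto simp: p_def q_def divide_simps)
  have "p * a + q * w = v"
    using assms by (simp add: p_def q_def divide_simps) (simp add: algebra_simps)
  then have "f v < p * f a + q * f w"
    using cvx pq assms unfolding strictly_convex_on_def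
    by (metis UNIV_I less_trans less_irrefl real_scaleR_def)
  moreover have "p * f a + q * f w - f a = q * (f w - f a)"
    using pq(3) by algebra
  ultimately have "f v - f a < q * (f w - f a)" by linarith
  then have "(f v - f a) / (v - a) < (f w - f a) / (w - a)"
    using assms by (simp add: q_def pos_divide_less_eq mult.commute)
  then show ?thesis
    using assms mult_strict_left_mono[of _ _ "\<mu> - a"]
    by (simp add: chord_value_eq_slope del: times_divide_eq_right)
qed

lemma chord_value_root_unique:
  assumes "strictly_convex_on UNIV f" "a < \<mu>" "a < v" "a < w"
    and "chord_value f \<mu> a v = chord_value f \<mu> a w"
  shows "v = w"
  using assms chord_value_strict_mono[of f a \<mu> v w] chord_value_strict_mono[of f a \<mu> w v]
  by linarith

text \<open>The chord shrinks to the point over \<open>\<mu>\<close> as its right end tends to \<open>\<mu>\<close>, and superlinear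
  growth lifts it without bound as its right end tends to infinity; the intermediate value
  theorem does the rest.\<close>

lemma chord_value_root_exists:
  assumes cont: "continuous_on UNIV f" and nonneg: "\<And>x. 0 \<le> f x" and "f \<mu> = 0"
    and growth: "filterlim (\<lambda>x. \<bar>f x / x\<bar>) at_top at_infinity"
    and "0 < s" "a < \<mu>"
  shows "\<exists>v>\<mu>. chord_value f \<mu> a v = s"
proof -
  define K where "K = 2 * s / (\<mu> - a)"
  have "K > 0" using assms by (simp add: K_def)
  have "eventually (\<lambda>x. K \<le> \<bar>f x / x\<bar>) at_top"
    using growth at_top_le_at_infinity unfolding filterlim_at_top by (metis filter_leD)
  then have "eventually (\<lambda>x. K \<le> \<bar>f x / x\<bar> \<and> max (max \<mu> \<bar>a\<bar>) 1 < x) at_top"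
    by (intro eventually_conj eventually_gt_at_top)
  then have "\<exists>M. K \<le> \<bar>f M / M\<bar> \<and> max (max \<mu> \<bar>a\<bar>) 1 < M"
    by (rule eventually_happens'[rotated]) simp
  then obtain M where M: "K \<le> \<bar>f M / M\<bar>" "\<mu> < M" "\<bar>a\<bar> < M" "1 < M"
    by auto
  have "K * M \<le> f M"
    using M nonneg[of M] by (simp add: pos_le_divide_eq)
  \<comment> \<open>\<open>K\<close> is chosen such that \<open>M - a \<le> 2 * M\<close> makes the right summand of the chord height
    at least \<open>s\<close>.\<close>
  have "s * (M - a) \<le> s * (2 * M)"
    using M \<open>0 < s\<close> by (intro mult_left_mono) auto
  also have "\<dots> = (\<mu> - a) * (K * M)"
    using \<open>a < \<mu>\<close> by (simp add: K_def)
  also have "\<dots> \<le> (\<mu> - a) * f M"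
    using \<open>K * M \<le> f M\<close> \<open>a < \<mu>\<close> by (intro mult_left_mono) auto
  finally have "s \<le> (\<mu> - a) / (M - a) * f M"
    using M by (simp add: pos_le_divide_eq)
  moreover have "0 \<le> (M - \<mu>) / (M - a) * f a"
    using M \<open>a < \<mu>\<close> nonneg by (intro mult_nonneg_nonneg divide_nonneg_nonneg) auto
  ultimately have "s \<le> chord_value f \<mu> a M" by (simp add: chord_value_def)
  moreover have "chord_value f \<mu> a \<mu> = 0"
    using \<open>f \<mu> = 0\<close> by (simp add: chord_value_def)
  moreover have "continuous_on {\<mu>..M} (chord_value f \<mu> a)"
    unfolding chord_value_def using \<open>a < \<mu>\<close>
    by (intro continuous_intros continuous_on_subset[OF cont]) auto
  ultimately obtain v where "\<mu> \<le> v" "chord_value f \<mu> a v = s"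
    using IVT'[of "chord_value f \<mu> a" \<mu> s M] \<open>0 < s\<close> M by auto
  then show ?thesis
    using \<open>chord_value f \<mu> a \<mu> = 0\<close> \<open>0 < s\<close> by (metis less_irrefl order_le_less)
qed

text \<open>The root for \<open>t\<close> is bracketed by points \<open>y\<close> and \<open>z\<close> where the height is below, respectively
  above, \<open>s\<close>. Both strict inequalities persist for nearby left end points \<open>a\<close>, and by monotonicity
  in the right end point they bracket the root for \<open>a\<close> as well.\<close>

lemma chord_value_root_tendsto:
  assumes cvx: "strictly_convex_on UNIV f" and cont: "continuous_on UNIV f"
    and t: "t < \<mu>" and v: "\<mu> < v" "chord_value f \<mu> t v = s"
    and u: "\<And>a. a < t \<Longrightarrow> \<mu> < u a \<and> chord_value f \<mu> a (u a) = s"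
  shows "(u \<longlongrightarrow> v) (at_left t)"
proof -
  have lim: "((\<lambda>a. chord_value f \<mu> a w) \<longlongrightarrow> chord_value f \<mu> t w) (at_left t)" if "\<mu> < w" for w
  proof -
    have "(f \<longlongrightarrow> f t) (at_left t)"
      using cont by (metis UNIV_I continuous_on_def subset_UNIV tendsto_within_subset)
    then show ?thesis
      unfolding chord_value_def using t that by (intro tendsto_intros) auto
  qed
  have left: "eventually (\<lambda>a. a < t) (at_left t)"
    by (simp add: eventually_at_filter)
  show ?thesis
  proof (rule order_tendstoI)
    fix y0 :: real assume "y0 < v"
    define y where "y = max y0 ((\<mu> + v) / 2)"
    have y: "\<mu> < y" "y < v" "y0 \<le> y"
      using \<open>y0 < v\<close> v(1) by (auto simp: y_def max_def field_simps)
    then have "chord_value f \<mu> t y < s"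
      using chord_value_strict_mono[OF cvx t, of y v] v t by simp
    from order_tendstoD(2)[OF lim[OF y(1)] this] left
    show "eventually (\<lambda>a. y0 < u a) (at_left t)"
    proof eventually_elim
      case (elim a)
      have "y < u a"
      proof (rule ccontr)
        assume "\<not> y < u a"
        then have "chord_value f \<mu> a (u a) \<le> chord_value f \<mu> a y"
          using chord_value_strict_mono[OF cvx, of a \<mu> "u a" y] u[of a] elim t
          by (cases "u a = y") auto
        then show False using u[of a] elim by simp
      qed
      then show ?case using y by simp
    qed
  next
    fix z assume "v < z"
    then have "s < chord_value f \<mu> t z"
      using chord_value_strict_mono[OF cvx t, of v z] v t by simp
    moreover have "\<mu> < z" using \<open>v < z\<close> v by simp
    ultimately have "eventually (\<lambda>a. s < chord_value f \<mu> a z) (at_left t)"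
      using order_tendstoD(1)[OF lim] by blast
    with left show "eventually (\<lambda>a. u a < z) (at_left t)"
    proof eventually_elim
      case (elim a)
      show ?case
      proof (rule ccontr)
        assume "\<not> u a < z"
        then have "chord_value f \<mu> a z \<le> chord_value f \<mu> a (u a)"
          using chord_value_strict_mono[OF cvx, of a \<mu> z "u a"] elim t \<open>\<mu> < z\<close>
          by (cases "u a = z") auto
        then show False using u[of a] elim by simp
      qed
    qed
  qed
qed

section \<open>Two-point distributions\<close>

lemma two_point_distribution_integral:
  fixes f :: "real \<Rightarrow> real"
  assumes P: "two_point_distribution \<mu> a v P" and f: "f \<in> borel_measurable borel"
  shows "integrable P f"
    and "(LINT x|P. f x) = measure P {a} * f a + measure P {v} * f v"
proof -
  interpret real_distribution P
    using P by (simp add: two_point_distribution_def)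
  let ?g = "\<lambda>x. f a * indicator {a} x + f v * indicator {v} x"
  have "a \<noteq> v" using P by (auto simp: two_point_distribution_def)
  have "{a, v} = {a} \<union> {v}" by auto
  then have "prob {a, v} = 1"
    using P \<open>a \<noteq> v\<close> finite_measure_Union[of "{a}" "{v}"]
    by (simp add: two_point_distribution_def)
  then have "AE x in P. x \<in> {a, v}"
    by (subst (asm) prob_eq_1) auto
  then have ae: "AE x in P. ?g x = f x"
    by eventually_elim (use \<open>a \<noteq> v\<close> in \<open>auto simp: indicator_def\<close>)
  have g: "integrable P ?g"
    by (intro Bochner_Integration.integrable_add integrable_mult_right) 
       (auto simp: integrable_indicator_iff emeasure_eq_measure)
  have meas: "f \<in> borel_measurable P" "?g \<in> borel_measurable P"
    using f g by auto
  show "integrable P f"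
    using integrable_cong_AE_imp[OF g meas(1)] ae by simp
  have "(LINT x|P. f x) = (LINT x|P. ?g x)"
    using ae by (intro integral_cong_AE meas) auto
  also have "\<dots> = measure P {a} * f a + measure P {v} * f v"
    by (subst Bochner_Integration.integral_add)
       (auto simp: integrable_indicator_iff emeasure_eq_measure)
  finally show "(LINT x|P. f x) = measure P {a} * f a + measure P {v} * f v" .
qed

lemma two_point_distribution_moments:
  assumes P: "two_point_distribution \<mu> a v P" and "P \<in> moment_class \<mu> s \<phi>"
    and "\<phi> \<in> borel_measurable borel"
  shows "chord_value \<phi> \<mu> a v = s"
proof -
  let ?p = "measure P {a}" and ?q = "measure P {v}"
  have av: "a < \<mu>" "\<mu> < v" and "?p = 1 - ?q"
    using P by (auto simp: two_point_distribution_def)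
  have "?p * a + ?q * v = \<mu>" and s: "?p * \<phi> a + ?q * \<phi> v = s"
    using assms two_point_distribution_integral(2)[OF P]
      two_point_distribution_integral(2)[OF P, of "\<lambda>x. x"]
    by (auto simp: moment_class_def)
  then have "?q * (v - a) = \<mu> - a"
    using \<open>?p = 1 - ?q\<close> by (simp add: algebra_simps)
  then have q: "?q = (\<mu> - a) / (v - a)"
    using av by (simp add: eq_divide_eq)
  moreover have "?p = (v - \<mu>) / (v - a)"
    using av \<open>?p = 1 - ?q\<close> unfolding q by (simp add: divide_simps)
  ultimately show ?thesis
    using s by (simp add: chord_value_def)
qed

lemma cond_expectation_ge_two_point:
  assumes P: "two_point_distribution \<mu> a v P" and "a < t" "t < \<mu>"
    and "\<psi> \<in> borel_measurable borel"
  shows "cond_expectation_ge P \<psi> t = \<psi> v"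
proof -
  interpret real_distribution P
    using P by (simp add: two_point_distribution_def)
  have "t < v" using assms by (simp add: two_point_distribution_def)
  have "(LINT x:{t..}|P. \<psi> x) = measure P {v} * \<psi> v"
    unfolding set_lebesgue_integral_def
    using assms \<open>t < v\<close> by (subst two_point_distribution_integral[OF P]) auto
  moreover have "measure P {t..} = (LINT x|P. indicator {t..} x)" by simp
  then have "measure P {t..} = measure P {v}"
    using \<open>a < t\<close> \<open>t < v\<close> by (subst (asm) two_point_distribution_integral[OF P]) auto
  ultimately show ?thesis
    using P by (simp add: cond_expectation_ge_def two_point_distribution_def)
qed

lemma two_point_distribution_exists:
  assumes "a < \<mu>" "\<mu> < v" and s: "chord_value \<phi> \<mu> a v = s"
    and meas: "\<phi> \<in> borel_measurable borel"
  shows "\<exists>P\<in>moment_class \<mu> s \<phi>. two_point_distribution \<mu> a v P"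
proof -
  define p where "p = (v - \<mu>) / (v - a)"
  have p: "0 < p" "p < 1" "1 - p = (\<mu> - a) / (v - a)"
    using assms by (auto simp: p_def divide_simps)
  define g where "g = (\<lambda>b. if b then a else v)"
  define P where "P = distr (measure_pmf (bernoulli_pmf p)) borel g"
  have P: "real_distribution P"
    unfolding P_def
    by (rule prob_space.real_distribution_distr) (auto simp: prob_space_measure_pmf)
  have "g -` {a} = {True}" "g -` {v} = {False}"
    using assms by (auto simp: g_def split: if_splits)
  then have w: "measure P {a} = p" "measure P {v} = 1 - p"
    using p by (auto simp: P_def measure_distr measure_pmf_single)
  have two: "two_point_distribution \<mu> a v P"
    using P w p assms by (simp add: two_point_distribution_def)
  have "(LINT x|P. x) = p * a + (1 - p) * v"
    using two_point_distribution_integral(2)[OF two, of "\<lambda>x. x"] w by simp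
  also have "\<dots> = \<mu>"
    using assms unfolding p(3) by (simp add: p_def divide_simps) (simp add: algebra_simps)
  finally have "(LINT x|P. x) = \<mu>" .
  moreover have "(LINT x|P. \<phi> x) = p * \<phi> a + (1 - p) * \<phi> v"
    using two_point_distribution_integral(2)[OF two meas] w by simp
  then have "(LINT x|P. \<phi> x) = s"
    using s unfolding p(3) by (simp add: p_def chord_value_def)
  ultimately have "P \<in> moment_class \<mu> s \<phi>"
    using P two_point_distribution_integral(1)[OF two meas]
      two_point_distribution_integral(1)[OF two, of "\<lambda>x. x"]
    by (simp add: moment_class_def)
  with two show ?thesis by blast
qed

section \<open>The upper bound\<close>

text \<open>With \<open>l\<close> the line through the graph of \<open>\<phi>\<close> over \<open>t\<close> and \<open>v\<close>, the function \<open>A * (\<phi> x - l x)\<close>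
  certifies the bound: it has integral \<open>0\<close> and dominates \<open>indicator {t..} x * (x - v)\<close>. The factor
  \<open>A\<close> is the one for which a supporting line of the function at \<open>v\<close> has slope \<open>1\<close>.\<close>

lemma truncated_mean_bound:
  assumes P: "P \<in> moment_class \<mu> s \<phi>" and cvx: "convex_on UNIV \<phi>"
    and "\<phi> \<mu> < s" "t < \<mu>" "\<mu> < v" and s: "chord_value \<phi> \<mu> t v = s"
  shows "(LINT x:{t..}|P. x - v) \<le> 0"
proof -
  interpret real_distribution P
    using P by (simp add: moment_class_def)
  define c where "c = (\<phi> v - \<phi> t) / (v - t)"
  define l where "l x = \<phi> v + c * (x - v)" for x
  have "c * (v - t) = \<phi> v - \<phi> t"
    using assms by (simp add: c_def)
  then have lt: "l t = \<phi> t" by (simp add: l_def algebra_simps)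
  have "l \<mu> = l t + c * (\<mu> - t)" by (simp add: l_def algebra_simps)
  then have "l \<mu> = s"
    using s chord_value_eq_slope[of t v \<phi> \<mu>] assms lt by (simp add: c_def)
  obtain m where m: "\<And>x. \<phi> v + m * (x - v) \<le> \<phi> x"
    using convex_on_real_supporting_line[OF cvx] by blast
  \<comment> \<open>At \<open>\<mu>\<close> the supporting line lies below \<open>\<phi>\<close>, hence below \<open>l\<close>; it meets \<open>l\<close> at \<open>v\<close>.\<close>
  have "0 < (m - c) * (v - \<mu>)"
    using m[of \<mu>] \<open>l \<mu> = s\<close> \<open>\<phi> \<mu> < s\<close> by (simp add: l_def algebra_simps)
  then have "c < m"
    using \<open>\<mu> < v\<close> by (simp add: zero_less_mult_iff)
  define A where "A = 1 / (m - c)"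
  have "A > 0" using \<open>c < m\<close> by (simp add: A_def)
  have above: "x - v \<le> A * (\<phi> x - l x)" for x
  proof -
    have "(m - c) * (x - v) \<le> \<phi> x - l x"
      using m[of x] by (simp add: l_def algebra_simps)
    then show ?thesis
      using \<open>c < m\<close> by (simp add: A_def pos_le_divide_eq mult.commute)
  qed
  \<comment> \<open>To the left of \<open>t\<close>, convexity puts \<open>\<phi>\<close> above the prolongation of its chord over \<open>[t, v]\<close>.\<close>
  have left: "0 \<le> A * (\<phi> x - l x)" if "x < t" for x
  proof -
    define q where "q = (v - t) / (v - x)"
    have q: "0 \<le> q" "q \<le> 1" "0 < q" using that assms by (auto simp: q_def)
    have "q * (v - x) = v - t" using that assms by (simp add: q_def)
    then have tq: "t = (1 - q) * v + q * x" by (simp add: algebra_simps)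
    have "\<phi> t \<le> (1 - q) * \<phi> v + q * \<phi> x"
      using convex_onD[OF cvx q(1,2), of v x] by (simp flip: tq)
    moreover have "l t = (1 - q) * \<phi> v + q * l x"
      unfolding l_def by (subst tq) (simp add: algebra_simps)
    ultimately have "q * l x \<le> q * \<phi> x" using lt by simp
    then have "l x \<le> \<phi> x" using q by simp
    then show ?thesis using \<open>A > 0\<close> by simp
  qed
  have int: "integrable P (\<lambda>x. x)" "integrable P \<phi>" "(LINT x|P. x) = \<mu>" "(LINT x|P. \<phi> x) = s"
    using P by (auto simp: moment_class_def)
  have "(LINT x:{t..}|P. x - v) \<le> (LINT x|P. A * (\<phi> x - l x))"
    unfolding set_lebesgue_integral_def
  proof (rule integral_mono)
    show "integrable P (\<lambda>x. indicator {t..} x *\<^sub>R (x - v))"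
      using int by (intro integrable_mult_indicator) auto
    show "integrable P (\<lambda>x. A * (\<phi> x - l x))"
      unfolding l_def using int by auto
    show "indicator {t..} x *\<^sub>R (x - v) \<le> A * (\<phi> x - l x)" for x
      using above[of x] left[of x] by (auto simp: indicator_def)
  qed
  also have "\<dots> = A * (s - l \<mu>)"
    unfolding l_def using int prob_space by simp
  finally show ?thesis using \<open>l \<mu> = s\<close> by simp
qed

text \<open>A supporting line of \<open>\<psi>\<close> at \<open>v\<close> reduces the bound for \<open>\<psi>\<close> to the one for the truncated
  mean. Monotonicity of \<open>\<psi>\<close> gives the slope the right sign.\<close>

lemma cond_expectation_ge_upper_bound:
  assumes P: "P \<in> moment_class \<mu> s \<phi>" and cvx: "convex_on UNIV \<phi>"
    and "\<phi> \<mu> < s" "t < \<mu>" "\<mu> < v" and s: "chord_value \<phi> \<mu> t v = s"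
    and conc: "concave_on UNIV \<psi>" and mono: "mono \<psi>"
  shows "cond_expectation_ge P \<psi> t \<le> \<psi> v"
proof -
  interpret real_distribution P
    using P by (simp add: moment_class_def)
  obtain m where "\<And>x. - \<psi> v + m * (x - v) \<le> - \<psi> x"
    using convex_on_real_supporting_line conc unfolding concave_on_def by blast
  then obtain d where d: "\<And>x. \<psi> x \<le> \<psi> v + d * (x - v)"
    by (metis le_minus_iff minus_add_distrib minus_minus mult_minus_left)
  have "\<psi> v \<le> \<psi> (v + 1)" using mono by (simp add: monoD)
  with d[of "v + 1"] have "0 \<le> d" by simp
  have "integrable P (\<lambda>x. x - v)"
    using P by (simp add: moment_class_def)
  then have lin: "set_integrable P {t..} (\<lambda>x. x - v)"
    and const: "set_integrable P {t..} (\<lambda>x. \<psi> v)"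
    unfolding set_integrable_def by (intro integrable_mult_indicator; simp)+
  have dlin: "set_integrable P {t..} (\<lambda>x. d * (x - v))"
    using lin by (rule set_integrable_mult_right)
  have "(LINT x:{t..}|P. \<psi> x) \<le> (LINT x:{t..}|P. \<psi> v + d * (x - v))"
    using moment_class_set_integrable_ge[OF P conc mono] set_integral_add(1)[OF const dlin] d
    by (rule set_integral_mono)
  also have "\<dots> = (LINT x:{t..}|P. \<psi> v) + d * (LINT x:{t..}|P. x - v)"
    using set_integral_add(2)[OF const dlin] by simp
  also have "\<dots> \<le> (LINT x:{t..}|P. \<psi> v)"
    using truncated_mean_bound[OF P cvx] assms \<open>0 \<le> d\<close> by (simp add: mult_nonneg_nonpos)
  also have "\<dots> = \<psi> v * measure P {t..}"
    by (simp add: set_lebesgue_integral_def)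
  finally show ?thesis
    using moment_class_measure_ge_pos[OF P \<open>t < \<mu>\<close>]
    by (simp add: cond_expectation_ge_def pos_divide_le_eq)
qed

section \<open>The supremum\<close>

theorem theorem3p1:
  fixes \<mu> s t :: real and \<phi> \<psi> :: "real \<Rightarrow> real"
  assumes "\<mu> > 0" and "s > 0"
    and "strictly_convex_on UNIV \<phi>"
    and "\<phi> differentiable_on (UNIV - {\<mu>})"
    and "filterlim (\<lambda>x. \<bar>\<phi> x / x\<bar>) at_top at_infinity"
    and "\<phi> \<mu> = 0"
    and "\<forall>x. \<phi> \<mu> \<le> \<phi> x"
    and "concave_on UNIV \<psi>" and "mono \<psi>"
    and "t < \<mu>"
  shows "\<exists>v2. (\<forall>v. v > \<mu> \<and> (v - \<mu>) / (v - t) * \<phi> t + (\<mu> - t) / (v - t) * \<phi> v = s \<longleftrightarrow> v = v2) \<and>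
     (SUP P\<in>moment_class \<mu> s \<phi>. ereal (cond_expectation_ge P \<psi> t)) = ereal (\<psi> v2) \<and>
     (\<forall>v1<t. \<exists>P\<in>moment_class \<mu> s \<phi>. \<exists>u. two_point_distribution \<mu> v1 u P) \<and>
     (\<forall>Q. (\<forall>v1<t. Q v1 \<in> moment_class \<mu> s \<phi> \<and> (\<exists>u. two_point_distribution \<mu> v1 u (Q v1))) \<longrightarrow>
        ((\<lambda>v1. cond_expectation_ge (Q v1) \<psi> t) \<longlongrightarrow> \<psi> v2) (at_left t))"
proof -
  have cvx: "convex_on UNIV \<phi>"
    using assms(3) by (rule strictly_convex_on_imp_convex_on)
  then have cont: "continuous_on UNIV \<phi>"
    by (intro convex_on_continuous) auto
  then have meas\<phi>: "\<phi> \<in> borel_measurable borel"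
    by (rule borel_measurable_continuous_onI)
  have meas\<psi>: "\<psi> \<in> borel_measurable borel"
    using assms(9) by (rule borel_measurable_mono)
  have root: "\<exists>v>\<mu>. chord_value \<phi> \<mu> a v = s" if "a < \<mu>" for a
    using assms that by (intro chord_value_root_exists cont) auto
  obtain v2 where v2: "\<mu> < v2" "chord_value \<phi> \<mu> t v2 = s"
    using root assms(10) by blast
  have uniq: "v > \<mu> \<and> (v - \<mu>) / (v - t) * \<phi> t + (\<mu> - t) / (v - t) * \<phi> v = s \<longleftrightarrow> v = v2" for v
    using chord_value_root_unique[OF assms(3,10), of v v2] v2 assms(10)
    unfolding chord_value_def[symmetric] by auto
  have two_point: "\<exists>P\<in>moment_class \<mu> s \<phi>. \<exists>u. two_point_distribution \<mu> a u P" if "a < t" for a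
    using root[of a] two_point_distribution_exists[of a \<mu> _ \<phi> s] meas\<phi> assms(10) that
    by (meson less_trans)
  have lim: "((\<lambda>a. cond_expectation_ge (Q a) \<psi> t) \<longlongrightarrow> \<psi> v2) (at_left t)"
    if Q: "\<forall>a<t. Q a \<in> moment_class \<mu> s \<phi> \<and> (\<exists>u. two_point_distribution \<mu> a u (Q a))" for Q
  proof -
    obtain u where u: "\<And>a. a < t \<Longrightarrow> two_point_distribution \<mu> a (u a) (Q a)"
      using Q by metis
    have "\<mu> < u a \<and> chord_value \<phi> \<mu> a (u a) = s" if "a < t" for a
      using two_point_distribution_moments[OF u[OF that] _ meas\<phi>] Q u[OF that] that
      by (auto simp: two_point_distribution_def)
    then have "(u \<longlongrightarrow> v2) (at_left t)"
      by (rule chord_value_root_tendsto[OF assms(3) cont assms(10) v2])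
    moreover have "isCont \<psi> v2"
      using concave_on_imp_continuous_on[OF assms(8)] continuous_on_eq_continuous_at by blast
    ultimately have "((\<lambda>a. \<psi> (u a)) \<longlongrightarrow> \<psi> v2) (at_left t)"
      by (metis isCont_tendsto_compose)
    moreover have "eventually (\<lambda>a. \<psi> (u a) = cond_expectation_ge (Q a) \<psi> t) (at_left t)"
      using cond_expectation_ge_two_point[OF u _ assms(10) meas\<psi>]
      by (simp add: eventually_at_filter)
    ultimately show ?thesis by (rule Lim_transform_eventually)
  qed
  let ?S = "SUP P\<in>moment_class \<mu> s \<phi>. ereal (cond_expectation_ge P \<psi> t)"
  have "?S = ereal (\<psi> v2)"
  proof (rule antisym)
    show "?S \<le> ereal (\<psi> v2)"
      using cond_expectation_ge_upper_bound[OF _ cvx _ assms(10) v2 assms(8,9)] assms(2,6)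
      by (intro SUP_least) auto
    obtain Q where Q: "\<forall>a<t. Q a \<in> moment_class \<mu> s \<phi> \<and> (\<exists>u. two_point_distribution \<mu> a u (Q a))"
      using two_point by metis
    show "ereal (\<psi> v2) \<le> ?S"
    proof (rule tendsto_upperbound)
      show "((\<lambda>a. ereal (cond_expectation_ge (Q a) \<psi> t)) \<longlongrightarrow> ereal (\<psi> v2)) (at_left t)"
        using lim[OF Q] by simp
      show "eventually (\<lambda>a. ereal (cond_expectation_ge (Q a) \<psi> t) \<le> ?S) (at_left t)"
        using Q by (auto simp: eventually_at_filter intro!: always_eventually SUP_upper)
    qed simp
  qed
  then show ?thesis
    using uniq two_point lim by (intro exI[of _ v2]) blast
qed

end
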